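(* Let (MICP) be $z_{IP}=\min\{f(\mathbf{x}):\mathbf{A}\mathbf{x}=\mathbf{b},\ \mathbf{x}\in X\}$ with $X=\{\mathbf{x}\in\mathbb{Z}^{n_1}\times\mathbb{R}^{n_2}:\mathbf{E}\mathbf{x}\le\mathbf{f}\}$, where $f:\mathbb{R}^n\to\mathbb{R}$ ($n=n_1+n_2$) is convex and differentiable, $\mathbf{A},\mathbf{E}$ are rational full-rank matrices and $\mathbf{b},\mathbf{f}$ are rational vectors; assume (MICP) and its continuous relaxation are feasible and have optimal solutions. Let $F_R$ be the feasible set of the continuous relaxation of (MICP), and let $\psi:\mathbb{R}^m\to\mathbb{R}_+$ be a level-bounded augmenting function. If $\mathbf{rec}(f)$ and $\mathbf{rec}(F_R)$ have no common non-trivial directions of recession, i.e. $\mathbf{rec}(f)\cap\mathbf{rec}(F_R)\setminus\{\mathbf{0}\}=\emptyset$, then $$\lim_{\rho\to\infty}z^{LD+}_\rho=z_{IP}.$$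
   Context: $m$ is the number of rows of $\mathbf{A}$. $F_R=\{\mathbf{x}\in\mathbb{R}^n:\mathbf{A}\mathbf{x}=\mathbf{b},\ \mathbf{E}\mathbf{x}\le\mathbf{f}\}$ (here $\mathbf{f}$ is a vector, distinct from the function $f$). The augmented Lagrangian dual with penalty parameter $\rho>0$ is $$z^{LD+}_\rho=\sup_{\boldsymbol\lambda\in\mathbb{R}^m}\ \min_{\mathbf{x}\in X}\ f(\mathbf{x})+\boldsymbol\lambda^\top(\mathbf{b}-\mathbf{A}\mathbf{x})+\rho\,\psi(\mathbf{b}-\mathbf{A}\mathbf{x}),$$ with the inner minimum read as an infimum if not attained. A level-bounded augmenting function is a proper, non-negative, lower semicontinuous $\psi:\mathbb{R}^m\to\mathbb{R}_+$ with $\psi(\mathbf{0})=0$, $\psi(\mathbf{u})>0$ for $\mathbf{u}\ne\mathbf{0}$, and $\operatorname{diam}\{\mathbf{u}:\psi(\mathbf{u})\le\delta\}<+\infty$ for all $\delta>0$; moreover $\lim_{\delta\downarrow0}\operatorname{diam}\{\mathbf{u}:\psi(\mathbf{u})\le\delta\}=0$. $\mathbf{rec}(S)$ is the recession cone of a set $S$; $\mathbf{rec}(f)$ is the recession cone of a (nonempty) level set $\{\mathbf{x}:f(\mathbf{x})\le\alpha\}$. *)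

theory Defs
  imports "HOL-Analysis.Analysis"
begin

definition rational_vec :: "real ^ 'i \<Rightarrow> bool" where
  "rational_vec v \<longleftrightarrow> (\<forall>i. v $ i \<in> \<rat>)"

definition rational_mat :: "real ^ 'j ^ 'i \<Rightarrow> bool" where
  "rational_mat M \<longleftrightarrow> (\<forall>i j. M $ i $ j \<in> \<rat>)"

definition full_rank :: "real ^ 'j ^ 'i \<Rightarrow> bool" where
  "full_rank M \<longleftrightarrow> rank M = min CARD('i) CARD('j)"

(* The mixed-integer lattice Z^n1 x R^n2 is given by the set I of integer coordinates:
   n1 = card I and n2 = card (- I), so that n1 = 0 and n2 = 0 are both allowed. *)
definition mixed_integer :: "'n set \<Rightarrow> (real ^ 'n) set" where
  "mixed_integer I = {x. \<forall>j\<in>I. x $ j \<in> \<int>}"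

(* The order on real ^ 'k is componentwise. *)
definition ineq_set :: "'n set \<Rightarrow> real ^ 'n ^ 'k \<Rightarrow> real ^ 'k \<Rightarrow> (real ^ 'n) set" where
  "ineq_set I E h = {x \<in> mixed_integer I. E *v x \<le> h}"

definition micp_feasible ::
  "'n set \<Rightarrow> real ^ 'n ^ 'm \<Rightarrow> real ^ 'm \<Rightarrow> real ^ 'n ^ 'k \<Rightarrow> real ^ 'k \<Rightarrow> (real ^ 'n) set" where
  "micp_feasible I A b E h = {x \<in> ineq_set I E h. A *v x = b}"

definition relaxation_feasible ::
  "real ^ 'n ^ 'm \<Rightarrow> real ^ 'm \<Rightarrow> real ^ 'n ^ 'k \<Rightarrow> real ^ 'k \<Rightarrow> (real ^ 'n) set" where
  "relaxation_feasible A b E h = {x. A *v x = b \<and> E *v x \<le> h}"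

definition has_optimal_solution :: "('a \<Rightarrow> real) \<Rightarrow> 'a set \<Rightarrow> bool" where
  "has_optimal_solution f S \<longleftrightarrow> (\<exists>x\<in>S. \<forall>y\<in>S. f x \<le> f y)"

(* Infimum in the extended reals; it is the minimum as soon as has_optimal_solution f S. *)
definition optimal_value :: "('a \<Rightarrow> real) \<Rightarrow> 'a set \<Rightarrow> ereal" where
  "optimal_value f S = (INF x\<in>S. ereal (f x))"

definition recession_cone :: "'a::real_vector set \<Rightarrow> 'a set" where
  "recession_cone S = {d. \<forall>x\<in>S. \<forall>t\<ge>0. x + t *\<^sub>R d \<in> S}"

definition lower_semicontinuous :: "('a::topological_space \<Rightarrow> real) \<Rightarrow> bool" where
  "lower_semicontinuous g \<longleftrightarrow> (\<forall>u. ereal (g u) \<le> Liminf (at u) (\<lambda>v. ereal (g v)))"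

(* Properness is automatic for a real-valued function. A finite diameter is expressed by
   boundedness, because the real-valued library constant diameter is unspecified on unbounded
   sets. *)
definition level_bounded_augmenting :: "(real ^ 'm \<Rightarrow> real) \<Rightarrow> bool" where
  "level_bounded_augmenting \<psi> \<longleftrightarrow>
     (\<forall>u. 0 \<le> \<psi> u) \<and> lower_semicontinuous \<psi> \<and>
     \<psi> 0 = 0 \<and> (\<forall>u. u \<noteq> 0 \<longrightarrow> 0 < \<psi> u) \<and>
     (\<forall>\<delta>>0. bounded {u. \<psi> u \<le> \<delta>}) \<and>
     ((\<lambda>\<delta>. diameter {u. \<psi> u \<le> \<delta>}) \<longlongrightarrow> 0) (at_right 0)"

definition augmented_lagrangian_dual ::
  "(real ^ 'n \<Rightarrow> real) \<Rightarrow> (real ^ 'n) set \<Rightarrow> real ^ 'n ^ 'm \<Rightarrow> real ^ 'm \<Rightarrow>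
   (real ^ 'm \<Rightarrow> real) \<Rightarrow> real \<Rightarrow> ereal" where
  "augmented_lagrangian_dual f X A b \<psi> \<rho> =
     (SUP l. optimal_value (\<lambda>x. f x + l \<bullet> (b - A *v x) + \<rho> * \<psi> (b - A *v x)) X)"

end

theory Submission
  imports Defs
begin

text \<open>Along a sequence in the polyhedron with bounded objective and \<open>A x\<close> tending to \<open>b\<close>, an
  unbounded subsequence would produce, after normalisation, a common direction of recession. So such
  sequences are bounded and have feasible limit points, which shows that \<open>f\<close> almost respects its
  constrained minimum on nearly feasible points, both in the relaxation and in \<open>X\<close>. For the
  relaxation this yields one multiplier \<open>l\<close> for which the ordinary Lagrangian is bounded below. With
  this \<open>l\<close>, a large penalty takes care of the points with \<open>b - A x\<close> away from \<open>0\<close>, and near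
  feasibility takes care of the others; integrality enters only through the closedness of \<open>X\<close>.\<close>

section \<open>Closedness and convexity of the constraint sets\<close>

lemma closed_polyhedron: "closed {x. (E :: real ^ 'n ^ 'k) *v x \<le> h}"
proof -
  have "closed ((\<lambda>x. E *v x) -` {..h})"
    by (intro continuous_closed_vimage closed_eucl_atMost linear_continuous_at
        matrix_vector_mul_bounded_linear)
  then show ?thesis
    by (simp add: vimage_def)
qed

lemma convex_polyhedron: "convex {x. (E :: real ^ 'n ^ 'k) *v x \<le> h}"
proof -
  have "convex ((\<lambda>x. E *v x) -` {..h})"
    by (intro convex_linear_vimage matrix_vector_mul_linear)
       (simp add: convex_def less_eq_vec_def convex_bound_le)
  then show ?thesis
    by (simp add: vimage_def)
qed

lemma closed_mixed_integer: "closed (mixed_integer I)"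
proof -
  have "mixed_integer I = (\<Inter>j\<in>I. (\<lambda>x. x $ j) -` \<int>)"
    by (auto simp: mixed_integer_def)
  then show ?thesis
    by (auto intro!: closed_INT continuous_closed_vimage continuous_intros)
qed

section \<open>Recession directions of sublevel sets and of the relaxation\<close>

text \<open>The point \<open>y + t *\<^sub>R d\<close> is a limit of convex combinations of
  \<open>y\<close> and \<open>x k\<close> whose weight on \<open>x k\<close> tends to 0. Convexity
  bounds \<open>f\<close> there by the same combination of \<open>\<alpha>\<close> and
  \<open>M\<close>, and \<open>M\<close> disappears in the limit; hence the level
  \<open>\<alpha>\<close> need not be related to \<open>M\<close>.\<close>

lemma recession_cone_sublevelI:
  fixes f :: "'a::real_normed_vector \<Rightarrow> real"
  assumes convex: "convex_on UNIV f" and cont: "continuous_on UNIV f"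
    and bound: "\<And>k. f (x k) \<le> M"
    and inf: "filterlim (\<lambda>k. norm (x k)) at_top sequentially"
    and dir: "(\<lambda>k. x k /\<^sub>R norm (x k)) \<longlonglongrightarrow> d"
  shows "d \<in> recession_cone {x. f x \<le> \<alpha>}"
  unfolding recession_cone_def
proof (intro CollectI ballI allI impI)
  fix y and t :: real
  assume y: "y \<in> {x. f x \<le> \<alpha>}" and t: "0 \<le> t"
  define s where "s k = t / norm (x k)" for k
  have s0: "s \<longlonglongrightarrow> 0"
    unfolding s_def by (intro tendsto_divide_0[OF tendsto_const]
        filterlim_at_top_imp_at_infinity inf)
  have "(\<lambda>k. (1 - s k) *\<^sub>R y + t *\<^sub>R (x k /\<^sub>R norm (x k))) \<longlonglongrightarrow> (1 - 0) *\<^sub>R y + t *\<^sub>R d"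
    by (intro tendsto_intros s0 dir)
  then have "(\<lambda>k. (1 - s k) *\<^sub>R y + s k *\<^sub>R x k) \<longlonglongrightarrow> y + t *\<^sub>R d"
    by (simp add: s_def divide_inverse)
  then have flim: "(\<lambda>k. f ((1 - s k) *\<^sub>R y + s k *\<^sub>R x k)) \<longlonglongrightarrow> f (y + t *\<^sub>R d)"
    using cont by (auto intro: continuous_on_tendsto_compose)
  have rlim: "(\<lambda>k. (1 - s k) * \<alpha> + s k * M) \<longlonglongrightarrow> (1 - 0) * \<alpha> + 0 * M"
    by (intro tendsto_intros s0)
  \<comment> \<open>Only from here on are \<open>1 - s k\<close> and \<open>s k\<close> weights of a
    convex combination.\<close>
  have "\<forall>\<^sub>F k in sequentially. s k < 1"
    using s0 by (rule order_tendstoD) simp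
  then have "\<forall>\<^sub>F k in sequentially.
      f ((1 - s k) *\<^sub>R y + s k *\<^sub>R x k) \<le> (1 - s k) * \<alpha> + s k * M"
  proof eventually_elim
    case (elim k)
    have "s k \<ge> 0"
      using t by (simp add: s_def)
    then have "f ((1 - s k) *\<^sub>R y + s k *\<^sub>R x k) \<le> (1 - s k) * f y + s k * f (x k)"
      using elim by (intro convex_onD[OF convex]) auto
    also have "\<dots> \<le> (1 - s k) * \<alpha> + s k * M"
      using elim \<open>s k \<ge> 0\<close> y bound by (intro add_mono mult_left_mono) auto
    finally show ?case .
  qed
  then show "f (y + t *\<^sub>R d) \<le> \<alpha>"
    using tendsto_le[OF _ rlim flim] by simp
qed

lemma recession_cone_relaxation_feasibleI:
  assumes A: "A *v d = 0" and E: "E *v d \<le> 0"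
  shows "d \<in> recession_cone (relaxation_feasible A b E h)"
  unfolding recession_cone_def relaxation_feasible_def
proof (clarsimp simp: matrix_vector_right_distrib matrix_vector_mult_scaleR A)
  fix x and t :: real
  assume "E *v x \<le> h" "0 \<le> t"
  then show "E *v x + t *\<^sub>R (E *v d) \<le> h"
    using add_mono[of "E *v x" h "t *\<^sub>R (E *v d)" 0] scaleR_left_mono[OF E, of t] by simp
qed

section \<open>Nearly feasible points, and a Lagrange multiplier for the relaxation\<close>

locale relaxation_recession =
  fixes f :: "real ^ 'n \<Rightarrow> real"
    and A :: "real ^ 'n ^ 'm" and b :: "real ^ 'm"
    and E :: "real ^ 'n ^ 'k" and h :: "real ^ 'k"
    and \<alpha> :: real
  assumes convex_f: "convex_on UNIV f"
    and recession:
      "recession_cone {x. f x \<le> \<alpha>} \<inter> recession_cone (relaxation_feasible A b E h) - {0} = {}"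
begin

lemma continuous_f: "continuous_on UNIV f"
  using convex_f by (intro convex_on_continuous) auto

text \<open>Otherwise some subsequence has norms tending to infinity and normalisations tending to a
  unit vector \<open>d\<close>. Dividing the bounded vectors \<open>A *v x k\<close> and the
  inequalities \<open>E *v x k \<le> h\<close> by these norms leaves \<open>A *v d = 0\<close> and
  \<open>E *v d \<le> 0\<close>, while the bound on \<open>f\<close> puts \<open>d\<close> into the
  recession cone of the sublevel set.\<close>

lemma bounded_near_feasible_sequence:
  assumes P: "\<And>k. E *v x k \<le> h" and bound: "\<And>k. f (x k) \<le> M"
    and lim: "(\<lambda>k. A *v x k) \<longlonglongrightarrow> b"
  shows "bounded (range x)"
proof (rule ccontr)
  assume "\<not> bounded (range x)"
  then have "\<forall>k::nat. \<exists>i. norm (x i) > real k"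
    unfolding bounded_iff by (metis not_le rangeE)
  then obtain q where q: "\<And>k::nat. norm (x (q k)) > real k"
    by metis
  define u where "u k = x (q k) /\<^sub>R norm (x (q k))" for k
  have "range u \<subseteq> sphere 0 1"
  proof -
    \<comment> \<open>The strict inequality in \<open>q\<close> excludes a zero vector, already for
      \<open>k = 0\<close>.\<close>
    have "norm (u k) = 1" for k
      using order.strict_trans1[OF of_nat_0_le_iff q, of k] by (simp add: u_def)
    then show ?thesis
      by auto
  qed
  then obtain d r where d: "d \<in> sphere 0 1" and r: "strict_mono r" "(u \<circ> r) \<longlonglongrightarrow> d"
    using compact_sphere[of "0 :: real ^ 'n" 1] unfolding compact_def by blast
  define y where "y k = x (q (r k))" for k
  have inf: "filterlim (\<lambda>k. norm (y k)) at_top sequentially"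
  proof (rule filterlim_at_top_mono)
    show "\<forall>\<^sub>F k in sequentially. real k \<le> norm (y k)"
    proof (rule always_eventually, rule allI)
      fix k
      have "k \<le> r k"
        using r(1) by (rule seq_suble)
      then show "real k \<le> norm (y k)"
        using q[of "r k"] by (simp add: y_def)
    qed
  qed (rule filterlim_real_sequentially)
  have dir: "(\<lambda>k. y k /\<^sub>R norm (y k)) \<longlonglongrightarrow> d"
    using r(2) by (simp add: u_def y_def comp_def)
  have inv: "(\<lambda>k. inverse (norm (y k))) \<longlonglongrightarrow> 0"
    using inf by (rule tendsto_inverse_0_at_top)
  \<comment> \<open>The number of rows is left general because this serves both \<open>A\<close> and
    \<open>E\<close>.\<close>
  have lim_mult: "(\<lambda>k. M *v (y k /\<^sub>R norm (y k))) \<longlonglongrightarrow> M *v d" for M :: "real ^ 'n ^ 'l"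
    using matrix_vector_mul_bounded_linear dir by (rule bounded_linear.tendsto)
  have "(\<lambda>k. A *v (y k /\<^sub>R norm (y k))) \<longlonglongrightarrow> 0"
  proof -
    have "bounded (range (\<lambda>k. A *v x k))"
      using lim by (rule convergent_imp_bounded)
    then obtain K where K: "\<And>k. norm (A *v x k) \<le> K"
      by (auto simp: bounded_iff)
    have "(\<lambda>k. inverse (norm (y k)) *\<^sub>R (A *v y k)) \<longlonglongrightarrow> 0"
    proof (rule Lim_null_comparison)
      show "\<forall>\<^sub>F k in sequentially.
          norm (inverse (norm (y k)) *\<^sub>R (A *v y k)) \<le> inverse (norm (y k)) * K"
        using K by (auto simp: y_def intro!: always_eventually mult_left_mono)
      show "(\<lambda>k. inverse (norm (y k)) * K) \<longlonglongrightarrow> 0"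
        using tendsto_mult_right[OF inv, of K] by simp
    qed
    then show ?thesis
      by (simp add: matrix_vector_mult_scaleR)
  qed
  with lim_mult have Ad: "A *v d = 0"
    using LIMSEQ_unique by blast
  have "E *v d \<le> 0"
  proof -
    have "(\<lambda>k. h /\<^sub>R norm (y k)) \<longlonglongrightarrow> 0 *\<^sub>R h"
      by (intro tendsto_intros inv)
    moreover have "E *v (y k /\<^sub>R norm (y k)) \<le> h /\<^sub>R norm (y k)" for k
      using P by (simp add: matrix_vector_mult_scaleR y_def scaleR_left_mono)
    ultimately have "E *v d \<le> 0 *\<^sub>R h"
      using lim_mult[of E] unfolding less_eq_vec_def
      by (blast intro: LIMSEQ_le tendsto_vec_nth)
    then show ?thesis
      by simp
  qed
  with Ad have "d \<in> recession_cone (relaxation_feasible A b E h)"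
    by (rule recession_cone_relaxation_feasibleI)
  moreover have "d \<in> recession_cone {x. f x \<le> \<alpha>}"
    by (rule recession_cone_sublevelI[OF convex_f continuous_f bound inf[unfolded y_def]
          dir[unfolded y_def]])
  ultimately show False
    using recession d by auto
qed

text \<open>A failure for every \<open>\<delta>\<close> gives points of \<open>S\<close> with
  residuals tending to 0 and \<open>f\<close> below \<open>c\<close>. They are bounded, so a
  subsequence converges to a feasible point of \<open>S\<close> with value at most
  \<open>c < M\<close>. The set \<open>S\<close> is general so that it can be the polyhedron, for
  the multiplier, as well as the mixed-integer set.\<close>

lemma near_feasible_lower_bound:
  assumes S: "closed S" "S \<subseteq> {x. E *v x \<le> h}"
    and lower: "\<And>x. x \<in> S \<Longrightarrow> A *v x = b \<Longrightarrow> M \<le> f x" and "c < M"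
  shows "\<exists>\<delta>>0. \<forall>x\<in>S. norm (b - A *v x) \<le> \<delta> \<longrightarrow> c \<le> f x"
proof (rule ccontr)
  assume "\<not> ?thesis"
  then have "\<exists>x\<in>S. norm (b - A *v x) \<le> \<delta> \<and> f x < c" if "\<delta> > 0" for \<delta>
    using that by (meson not_le)
  then have "\<forall>k::nat. \<exists>x\<in>S. norm (b - A *v x) \<le> inverse (real (Suc k)) \<and> f x < c"
    by (metis inverse_positive_iff_positive of_nat_0_less_iff zero_less_Suc)
  then obtain x where x: "\<And>k. x k \<in> S" "\<And>k. norm (b - A *v x k) \<le> inverse (real (Suc k))"
      "\<And>k. f (x k) < c"
    by metis
  have "(\<lambda>k. b - A *v x k) \<longlonglongrightarrow> 0"
    by (rule Lim_null_comparison[OF _ LIMSEQ_inverse_real_of_nat]) (use x(2) in auto)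
  then have "(\<lambda>k. b - (b - A *v x k)) \<longlonglongrightarrow> b - 0"
    by (intro tendsto_intros)
  then have lim: "(\<lambda>k. A *v x k) \<longlonglongrightarrow> b"
    by simp
  then have "bounded (range x)"
    using S(2) x(1,3) by (intro bounded_near_feasible_sequence) (auto intro: less_imp_le)
  then obtain y r where r: "strict_mono r" "(x \<circ> r) \<longlonglongrightarrow> y"
    using bounded_imp_convergent_subsequence by metis
  have "y \<in> S"
    by (rule closed_sequentially[OF S(1) _ r(2)]) (simp add: x(1))
  moreover have "(\<lambda>k. A *v (x \<circ> r) k) \<longlonglongrightarrow> A *v y"
    using matrix_vector_mul_bounded_linear r(2) by (rule bounded_linear.tendsto)
  then have "A *v y = b"
    using LIMSEQ_subseq_LIMSEQ[OF lim r(1)] LIMSEQ_unique by (auto simp: comp_def)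
  moreover have "(\<lambda>k. f ((x \<circ> r) k)) \<longlonglongrightarrow> f y"
    using continuous_on_tendsto_compose[OF continuous_f r(2)] by simp
  then have "f y \<le> c"
    using x(3) by (intro LIMSEQ_le_const2) (auto intro: less_imp_le)
  ultimately show False
    using lower \<open>c < M\<close> by fastforce
qed

text \<open>The multiplier comes from a hyperplane strictly separating the epigraph of the value function
  of the relaxation from a point below its value at \<open>0\<close>; the epigraph contains
  \<open>(0, f x\<^sub>0)\<close> above that point, so the hyperplane is not vertical.\<close>

lemma bounding_multiplier:
  assumes x0: "x0 \<in> relaxation_feasible A b E h"
    and opt: "\<And>x. x \<in> relaxation_feasible A b E h \<Longrightarrow> f x0 \<le> f x"
  obtains l where "\<And>x. E *v x \<le> h \<Longrightarrow> f x0 - 1 \<le> f x + l \<bullet> (b - A *v x)"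
proof -
  define C where "C = {(b - A *v x, t) | x t. E *v x \<le> h \<and> f x \<le> t}"
  have "convex C"
    unfolding convex_def
  proof (intro ballI allI impI)
    fix p p' and u v :: real
    assume "p \<in> C" "p' \<in> C" and uv: "0 \<le> u" "0 \<le> v" "u + v = 1"
    then obtain x t x' t' where p: "p = (b - A *v x, t)" "E *v x \<le> h" "f x \<le> t"
      and p': "p' = (b - A *v x', t')" "E *v x' \<le> h" "f x' \<le> t'"
      by (auto simp: C_def)
    have "E *v (u *\<^sub>R x + v *\<^sub>R x') \<le> h"
      using convexD[OF convex_polyhedron, of x E h x' u v] p p' uv by simp
    moreover have "f (u *\<^sub>R x + v *\<^sub>R x') \<le> u * t + v * t'"
    proof -
      have "f (u *\<^sub>R x + v *\<^sub>R x') \<le> u * f x + v * f x'"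
        using convex_f uv by (auto simp: convex_on_def)
      also have "\<dots> \<le> u * t + v * t'"
        using p p' uv by (intro add_mono mult_left_mono) auto
      finally show ?thesis .
    qed
    moreover have "u *\<^sub>R (b - A *v x) + v *\<^sub>R (b - A *v x') = b - A *v (u *\<^sub>R x + v *\<^sub>R x')"
    proof -
      have "u *\<^sub>R b + v *\<^sub>R b = b"
        using uv by (simp flip: scaleR_add_left)
      then show ?thesis
        by (simp add: matrix_vector_right_distrib matrix_vector_mult_scaleR algebra_simps)
    qed
    ultimately show "u *\<^sub>R p + v *\<^sub>R p' \<in> C"
      using p(1) p'(1) by (auto simp: C_def)
  qed
  \<comment> \<open>Near feasibility with margin 1/2: a pair in \<open>C\<close> with first
    component of norm at most \<open>\<delta>\<close> has second component at least
    \<open>f x0 - 1 / 2\<close>, so it stays at distance at least 1/2 from this point.\<close>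
  have "(0, f x0 - 1) \<notin> closure C"
  proof
    assume "(0, f x0 - 1) \<in> closure C"
    obtain \<delta> where "\<delta> > 0"
      and \<delta>: "\<And>x. E *v x \<le> h \<Longrightarrow> norm (b - A *v x) \<le> \<delta> \<Longrightarrow> f x0 - 1 / 2 \<le> f x"
      using near_feasible_lower_bound[OF closed_polyhedron order_refl, of "f x0" "f x0 - 1 / 2"]
        opt by (auto simp: relaxation_feasible_def)
    obtain p where "p \<in> C" and p: "dist p (0, f x0 - 1) < min \<delta> (1 / 2)"
      using \<open>(0, f x0 - 1) \<in> closure C\<close> \<open>\<delta> > 0\<close> closure_approachable
      by (metis half_gt_zero_iff min_less_iff_conj zero_less_one)
    from \<open>p \<in> C\<close> obtain x t where x: "p = (b - A *v x, t)" "E *v x \<le> h" "f x \<le> t"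
      by (auto simp: C_def)
    have "norm (b - A *v x) \<le> \<delta>" "t < f x0 - 1 / 2"
      using p dist_fst_le[of p "(0, f x0 - 1)"] dist_snd_le[of p "(0, f x0 - 1)"]
      by (auto simp: x(1) dist_real_def)
    then show False
      using \<delta> x by fastforce
  qed
  then obtain a c where ac: "a \<bullet> (0, f x0 - 1) < c" "\<And>p. p \<in> closure C \<Longrightarrow> c < a \<bullet> p"
    using separating_hyperplane_closed_point[of "closure C" "(0, f x0 - 1)"] \<open>convex C\<close>
    by (metis closed_closure convex_closure)
  obtain \<mu> s where a: "a = (\<mu>, s)"
    by fastforce
  have sep: "s * (f x0 - 1) < \<mu> \<bullet> (b - A *v x) + s * f x" if "E *v x \<le> h" for x
  proof -
    have "(b - A *v x, f x) \<in> closure C"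
      using that closure_subset by (fastforce simp: C_def)
    then show ?thesis
      using ac by (fastforce simp: a)
  qed
  have "s > 0"
    using sep[of x0] x0 by (simp add: relaxation_feasible_def algebra_simps)
  show thesis
  proof
    fix x assume "E *v x \<le> h"
    have "s * (f x + (\<mu> /\<^sub>R s) \<bullet> (b - A *v x)) = \<mu> \<bullet> (b - A *v x) + s * f x"
      using \<open>s > 0\<close> by (simp add: field_simps)
    also have "\<dots> > s * (f x0 - 1)"
      using sep \<open>E *v x \<le> h\<close> .
    finally show "f x0 - 1 \<le> f x + (\<mu> /\<^sub>R s) \<bullet> (b - A *v x)"
      using \<open>s > 0\<close> by simp
  qed
qed

end

section \<open>Growth of the augmenting function away from 0, and weak duality\<close>

text \<open>Each level set with \<open>\<eta> > 0\<close> contains 0, so once its diameter is below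
  \<open>\<delta>\<close> it lies in the open ball of radius \<open>\<delta>\<close> around 0.
  Boundedness of the level set is what lets \<open>diameter\<close> bound distances.\<close>

lemma level_bounded_augmenting_away_from_0:
  fixes \<psi> :: "real ^ 'm \<Rightarrow> real"
  assumes \<psi>: "level_bounded_augmenting \<psi>" and "\<delta> > 0"
  obtains \<eta> where "\<eta> > 0" "\<And>u. \<delta> \<le> norm u \<Longrightarrow> \<eta> < \<psi> u"
proof -
  have "((\<lambda>\<eta>. diameter {u. \<psi> u \<le> \<eta>}) \<longlongrightarrow> 0) (at_right 0)"
    using \<psi> by (simp add: level_bounded_augmenting_def)
  then have "\<forall>\<^sub>F \<eta> in at_right 0. diameter {u. \<psi> u \<le> \<eta>} < \<delta>"
    using \<open>\<delta> > 0\<close> by (rule order_tendstoD)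
  moreover have "\<forall>\<^sub>F \<eta> in at_right (0 :: real). \<eta> > 0"
    by (rule eventually_at_right_less)
  ultimately have "\<forall>\<^sub>F \<eta> in at_right 0. \<eta> > 0 \<and> diameter {u. \<psi> u \<le> \<eta>} < \<delta>"
    by eventually_elim simp
  then obtain \<eta> where \<eta>: "\<eta> > 0" "diameter {u. \<psi> u \<le> \<eta>} < \<delta>"
    using eventually_happens' trivial_limit_at_right_real by blast
  show thesis
  proof
    fix u :: "real ^ 'm" assume "\<delta> \<le> norm u"
    show "\<eta> < \<psi> u"
    proof (rule ccontr)
      assume "\<not> \<eta> < \<psi> u"
      then have "dist u 0 \<le> diameter {u. \<psi> u \<le> \<eta>}"
        using \<psi> \<eta>(1) by (intro diameter_bounded_bound) (auto simp: level_bounded_augmenting_def)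
      then show False
        using \<eta>(2) \<open>\<delta> \<le> norm u\<close> by simp
    qed
  qed (rule \<eta>(1))
qed

text \<open>Weak duality: at a feasible point the residual is 0, so the multiplier term and the
  penalty both vanish.\<close>

lemma augmented_lagrangian_dual_le:
  assumes "\<psi> 0 = 0"
  shows "augmented_lagrangian_dual f (ineq_set I E h) A b \<psi> \<rho>
    \<le> optimal_value f (micp_feasible I A b E h)"
  unfolding augmented_lagrangian_dual_def optimal_value_def
proof (intro SUP_least INF_greatest)
  fix l x assume "x \<in> micp_feasible I A b E h"
  with assms show "(INF x\<in>ineq_set I E h. ereal (f x + l \<bullet> (b - A *v x) + \<rho> * \<psi> (b - A *v x)))
      \<le> ereal (f x)"
    by (intro INF_lower2[of x]) (auto simp: micp_feasible_def)
qed

section \<open>Convergence of the dual values\<close>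

theorem proposition4p16:
  fixes f :: "real ^ 'n \<Rightarrow> real"
    and I :: "'n set"
    and A :: "real ^ 'n ^ 'm" and b :: "real ^ 'm"
    and E :: "real ^ 'n ^ 'k" and h :: "real ^ 'k"
    and \<psi> :: "real ^ 'm \<Rightarrow> real"
    and \<alpha> :: real
  assumes "convex_on UNIV f" and "\<forall>x. f differentiable (at x)"
    and "rational_mat A" and "full_rank A" and "rational_vec b"
    and "rational_mat E" and "full_rank E" and "rational_vec h"
    and "micp_feasible I A b E h \<noteq> {}"
    and "has_optimal_solution f (micp_feasible I A b E h)"
    and "relaxation_feasible A b E h \<noteq> {}"
    and "has_optimal_solution f (relaxation_feasible A b E h)"
    and "level_bounded_augmenting \<psi>"
    and "{x. f x \<le> \<alpha>} \<noteq> {}"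
    and "recession_cone {x. f x \<le> \<alpha>} \<inter> recession_cone (relaxation_feasible A b E h) - {0} = {}"
  shows "((\<lambda>\<rho>. augmented_lagrangian_dual f (ineq_set I E h) A b \<psi> \<rho>)
           \<longlongrightarrow> optimal_value f (micp_feasible I A b E h)) at_top"
proof -
  interpret relaxation_recession f A b E h \<alpha>
    using assms by unfold_locales
  obtain z where z: "z \<in> micp_feasible I A b E h" "\<And>x. x \<in> micp_feasible I A b E h \<Longrightarrow> f z \<le> f x"
    using assms(10) by (auto simp: has_optimal_solution_def)
  obtain x0 where x0: "x0 \<in> relaxation_feasible A b E h"
    "\<And>x. x \<in> relaxation_feasible A b E h \<Longrightarrow> f x0 \<le> f x"
    using assms(12) by (auto simp: has_optimal_solution_def)
  obtain l where l: "\<And>x. E *v x \<le> h \<Longrightarrow> f x0 - 1 \<le> f x + l \<bullet> (b - A *v x)"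
    using bounding_multiplier[OF x0] by blast
  have \<psi>: "\<psi> 0 = 0" "\<And>u. 0 \<le> \<psi> u"
    using assms(13) by (auto simp: level_bounded_augmenting_def)
  have X: "closed (ineq_set I E h)" "ineq_set I E h \<subseteq> {x. E *v x \<le> h}"
    using closed_Int[OF closed_mixed_integer closed_polyhedron, of I E h]
    by (auto simp: ineq_set_def Int_def)
  have opt: "optimal_value f (micp_feasible I A b E h) = ereal (f z)"
    unfolding optimal_value_def using z by (intro antisym INF_lower2[of z] INF_greatest) auto
  \<comment> \<open>The supremum over multipliers is tested at the single \<open>l\<close>, which
    depends on neither \<open>\<rho>\<close> nor \<open>\<epsilon>\<close>.\<close>
  have lower: "\<forall>\<^sub>F \<rho> in at_top.
      ereal (f z - \<epsilon>) \<le> augmented_lagrangian_dual f (ineq_set I E h) A b \<psi> \<rho>"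
    if "\<epsilon> > 0" for \<epsilon>
  proof -
    obtain \<delta>1 where "\<delta>1 > 0" and
      \<delta>1: "\<And>x. x \<in> ineq_set I E h \<Longrightarrow> norm (b - A *v x) \<le> \<delta>1 \<Longrightarrow> f z - \<epsilon> / 2 \<le> f x"
      using near_feasible_lower_bound[OF X, of "f z" "f z - \<epsilon> / 2"] z \<open>\<epsilon> > 0\<close>
      by (auto simp: micp_feasible_def)
    \<comment> \<open>Half of \<open>\<epsilon>\<close> is spent on \<open>f\<close> through
      \<open>\<delta>1\<close>; the second bound keeps the multiplier term within the other half by
      Cauchy-Schwarz. Adding 1 to \<open>norm l\<close> avoids dividing by 0.\<close>
    define \<delta> where "\<delta> = min \<delta>1 (\<epsilon> / (2 * (norm l + 1)))"
    have pos: "norm l + 1 > 0"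
      by (simp add: add_nonneg_pos)
    then have "\<delta> > 0"
      using \<open>\<delta>1 > 0\<close> \<open>\<epsilon> > 0\<close> by (simp add: \<delta>_def)
    then obtain \<eta> where \<eta>: "\<eta> > 0" "\<And>u. \<delta> \<le> norm u \<Longrightarrow> \<eta> < \<psi> u"
      using level_bounded_augmenting_away_from_0[OF assms(13)] by blast
    \<comment> \<open>For residuals longer than \<open>\<delta>\<close> the penalty exceeds
      \<open>\<rho> * \<eta>\<close> or equals it, and the threshold on \<open>\<rho>\<close> makes
      this cover the gap from \<open>f x0 - 1\<close> up to \<open>f z\<close>. The maximum with 0
      keeps the penalty nonnegative near feasibility.\<close>
    have bound: "f z - \<epsilon> \<le> f x + l \<bullet> (b - A *v x) + \<rho> * \<psi> (b - A *v x)"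
      if "\<rho> \<ge> max 0 ((f z - f x0 + 1) / \<eta>)" and x: "x \<in> ineq_set I E h" for \<rho> x
    proof (cases "norm (b - A *v x) \<le> \<delta>")
      case True
      have "\<bar>l \<bullet> (b - A *v x)\<bar> \<le> norm l * norm (b - A *v x)"
        by (rule Cauchy_Schwarz_ineq2)
      also have "\<dots> \<le> (norm l + 1) * (\<epsilon> / (2 * (norm l + 1)))"
        using True by (intro mult_mono) (auto simp: \<delta>_def)
      also have "\<dots> = \<epsilon> / 2"
        using pos by (simp add: field_simps)
      finally have "- (\<epsilon> / 2) \<le> l \<bullet> (b - A *v x)"
        by simp
      moreover have "f z - \<epsilon> / 2 \<le> f x"
        using \<delta>1 x True by (simp add: \<delta>_def)
      moreover have "0 \<le> \<rho> * \<psi> (b - A *v x)"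
        using that \<psi>(2) by simp
      ultimately show ?thesis
        by simp
    next
      case False
      then have "\<eta> \<le> \<psi> (b - A *v x)"
        using \<eta>(2) by (simp add: less_imp_le)
      then have "\<rho> * \<eta> \<le> \<rho> * \<psi> (b - A *v x)"
        using that by (intro mult_left_mono) auto
      moreover have "f z - f x0 + 1 \<le> \<rho> * \<eta>"
        using that \<eta>(1) by (simp add: divide_le_eq)
      moreover have "f x0 - 1 \<le> f x + l \<bullet> (b - A *v x)"
        using l X(2) x by blast
      ultimately show ?thesis
        using \<open>\<epsilon> > 0\<close> by simp
    qed
    have "ereal (f z - \<epsilon>) \<le> augmented_lagrangian_dual f (ineq_set I E h) A b \<psi> \<rho>"
      if "\<rho> \<ge> max 0 ((f z - f x0 + 1) / \<eta>)" for \<rho>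
      unfolding augmented_lagrangian_dual_def optimal_value_def
      by (intro SUP_upper2[of l] INF_greatest) (use bound that in auto)
    then show ?thesis
      unfolding eventually_at_top_linorder by blast
  qed
  show ?thesis
    unfolding opt
  proof (rule order_tendstoI)
    \<comment> \<open>Since \<open>a\<close> may be minus infinity, a real \<open>r\<close> between
      \<open>a\<close> and \<open>f z\<close> is chosen first, and \<open>lower\<close> is applied
      with \<open>\<epsilon> = f z - r\<close>.\<close>
    fix a assume "a < ereal (f z)"
    then obtain r where r: "a < ereal r" "r < f z"
      using ereal_dense2[of a "f z"] by auto
    have "\<forall>\<^sub>F \<rho> in at_top.
      ereal (f z - (f z - r)) \<le> augmented_lagrangian_dual f (ineq_set I E h) A b \<psi> \<rho>"
      using r(2) by (intro lower) simp
    then show "\<forall>\<^sub>F \<rho> in at_top. a < augmented_lagrangian_dual f (ineq_set I E h) A b \<psi> \<rho>"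
      by eventually_elim (use r(1) in \<open>auto intro: less_le_trans\<close>)
  next
    fix a assume "ereal (f z) < a"
    then show "\<forall>\<^sub>F \<rho> in at_top. augmented_lagrangian_dual f (ineq_set I E h) A b \<psi> \<rho> < a"
      using augmented_lagrangian_dual_le[where \<psi> = \<psi>, OF \<psi>(1), of f I E h A b]
      by (auto simp: opt intro!: always_eventually intro: le_less_trans)
  qed
qed

end
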